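(* Let $K$ be a non-Archimedean local field with residue cardinality $q$, let $n\ge 1$ be an integer, let $N\in\mathbb Z$ with $N\le -1$, and let $\Omega=\{x\in K^n:\ \|x\|_{K^n}\le q^N\}$. For $\alpha>n$ let $G_\alpha(t,x,y)$ ($t>0$, $x,y\in\Omega$) be the heat kernel on $\Omega$ of the Vladimirov–Taibleson operator $D^{\alpha,n}$ with the nonlocal homogeneous Dirichlet condition (zero on $K^n\setminus\Omega$), as defined in the context. Suppose that $n<\alpha_0<\alpha_1$. Then $$G_{\alpha_0}(t,x,x)>G_{\alpha_1}(t,x,x)\qquad\text{for all } t>0,\ x\in\Omega.$$
   Context: A non-Archimedean local field $K$ is a non-discrete totally disconnected locally compact topological field. Let $|\cdot|_K$ be its normalized absolute value, $O=\{x\in K:|x|_K\le 1\}$, $P=\{x\in K:|x|_K<1\}=\beta O$, $q=\#(O/P)$ (finite), $|\beta|_K=q^{-1}$. On $K^n$ use the norm $\|(x_1,\dots,x_n)\|_{K^n}=\max_{1\le j\le n}|x_j|_K$ and the Haar measure $dy$ (also denoted $\operatorname{mes}$) normalized so that $\operatorname{mes}(O^n)=1$. For $\alpha>0$ set $c_{n,\alpha}=\dfrac{q^\alpha-1}{1-q^{-\alpha-n}}$. The Vladimirov–Taibleson operator is $$(D^{\alpha,n}u)(x)=c_{n,\alpha}\int_{K^n}\frac{u(x)-u(y)}{\|x-y\|_{K^n}^{n+\alpha}}\,dy,\qquad x\in\Omega,$$ where functions $u$ on $\Omega$ are extended by $0$ to $K^n\setminus\Omega$. The associated heat problem is $\partial_t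 u+D^{\alpha,n}u=0$ for $x\in\Omega$, $t>0$; $u(t,x)=0$ for $x\in K^n\setminus\Omega$; $u(0,x)=\varphi(x)$ for $x\in\Omega$. For $x\in\Omega$ the operator equals $\Delta_\Omega^\alpha+\lambda_N^{(\alpha)}$, where $$(\Delta_\Omega^\alpha u)(x)=c_{n,\alpha}\int_\Omega\frac{u(x)-u(y)}{\|x-y\|_{K^n}^{n+\alpha}}\,dy,\qquad \lambda_N^{(\alpha)}=c_{n,\alpha}\int_{\|y\|_{K^n}>q^N}\frac{dy}{\|y\|_{K^n}^{n+\alpha}}=\frac{1-q^{-n}}{1-q^{-\alpha-n}}\,q^{-\alpha N}.$$ Kozyrev wavelets: for each ball $B=\{x:\|x-a\|_{K^n}\le q^m\}\subset\Omega$ ($m\le N$, one chosen center $a=a_B\in\Omega$ for each ball, $B=\Omega$ included) and each nontrivial character $\chi$ of the finite additive group $(O/P)^n$, the wavelet is $\psi(x)=(\operatorname{mes}B)^{-1/2}\,\chi\big(\beta^{m}(x-a)\bmod P\big)$ for $x\in B$ and $\psi(x)=0$ for $x\in\Omega\setminus B$. Together with the normalized constant function these form an orthonormal basis of $L^2(\Omega)$, and each $\psi$ is an eigenfunction of $\Delta_\Omega^\alpha$ with eigenvalue $$\rho_\psi=\rho_\psi^{(\alpha)}=c_{n,\alpha}\left\{\int_{\Omega\setminus B}\|x-y\|_{K^n}^{-\alpha-n}\,dy+(\operatorname{mes}B)^{-\alpha/n}\right\},$$ where $B$ is the supporting ball of $\psi$ and $x$ is any point of $B$ (the value does not depend on $x\in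 B$). The heat kernel (fundamental solution) of the heat problem $\partial_t u+D^{\alpha,n}u=0$ for $x\in\Omega$, $t>0$, with $u(t,x)=0$ for $x\in K^n\setminus\Omega$ and $u(0,x)=\varphi(x)$ for $x\in\Omega$, is $$G_\alpha(t,x,y)=e^{-\lambda_N^{(\alpha)}t}H_\alpha(t,x,y),\qquad H_\alpha(t,x,y)=\frac1{\operatorname{mes}\Omega}+\sum_\psi e^{-t\rho_\psi^{(\alpha)}}\psi(x)\overline{\psi(y)},$$ the sum running over all wavelets $\psi$ on $\Omega$; for $\alpha>n$ it is defined also on the diagonal $x=y$, $t>0$. Here $\operatorname{mes}\Omega=q^{nN}$. *)

theory Defs
  imports "HOL-Analysis.Analysis" "HOL-Library.Set_Algebras"
begin

class nonarch_local_field =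
  field + topological_ab_group_add + topological_semigroup_mult + t2_space +
  assumes tendsto_inverse_nhds:
      "a \<noteq> 0 \<Longrightarrow> filterlim inverse (nhds (inverse a)) (nhds a)"
    and nondiscrete: "\<exists>S. \<not> open S"
    and totally_disconnected: "connected S \<Longrightarrow> \<exists>x. S \<subseteq> {x}"
    and locally_compact: "\<exists>U C. open U \<and> compact C \<and> x \<in> U \<and> U \<subseteq> C"

definition int_ring :: "('k::nonarch_local_field \<Rightarrow> real) \<Rightarrow> 'k set" where
  "int_ring v = {x. v x \<le> 1}"

definition max_ideal :: "('k::nonarch_local_field \<Rightarrow> real) \<Rightarrow> 'k set" where
  "max_ideal v = {x. v x < 1}"

definition uniformizer :: "('k::nonarch_local_field \<Rightarrow> real) \<Rightarrow> 'k \<Rightarrow> bool" where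
  "uniformizer v \<beta> \<longleftrightarrow> max_ideal v = (\<lambda>x. \<beta> * x) ` int_ring v"

text \<open>The elements of the residue field are the cosets \<open>x +o max_ideal v\<close>; their addition is
  the element-wise sum of sets from \<^theory>\<open>HOL-Library.Set_Algebras\<close>.\<close>

definition residue_field :: "('k::nonarch_local_field \<Rightarrow> real) \<Rightarrow> 'k set set" where
  "residue_field v = (\<lambda>x. x +o max_ideal v) ` int_ring v"

definition resq :: "('k::nonarch_local_field \<Rightarrow> real) \<Rightarrow> real" where
  "resq v = real (card (residue_field v))"

text \<open>The absolute value that induces the given topology of the field, scaled so that a
  uniformizer has absolute value \<open>1 / resq v\<close>.\<close>

definition normalized_abs_val :: "('k::nonarch_local_field \<Rightarrow> real) \<Rightarrow> bool" where
  "normalized_abs_val v \<longleftrightarrow>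
     (\<forall>x. 0 \<le> v x) \<and> (\<forall>x. v x = 0 \<longleftrightarrow> x = 0) \<and>
     (\<forall>x y. v (x * y) = v x * v y) \<and>
     (\<forall>x y. v (x + y) \<le> max (v x) (v y)) \<and>
     (\<forall>S. open S \<longleftrightarrow> (\<forall>x\<in>S. \<exists>e>0. {y. v (y - x) < e} \<subseteq> S)) \<and>
     (\<forall>\<beta>. uniformizer v \<beta> \<longrightarrow> v \<beta> = 1 / resq v)"

definition vnorm :: "('k::nonarch_local_field \<Rightarrow> real) \<Rightarrow> 'k ^ 'n \<Rightarrow> real" where
  "vnorm v x = Max (range (\<lambda>i. v (x $ i)))"

definition vball :: "('k::nonarch_local_field \<Rightarrow> real) \<Rightarrow> 'k ^ 'n \<Rightarrow> int \<Rightarrow> ('k ^ 'n) set" where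
  "vball v a m = {x. vnorm v (x - a) \<le> resq v powi m}"

definition Omega :: "('k::nonarch_local_field \<Rightarrow> real) \<Rightarrow> int \<Rightarrow> ('k ^ 'n) set" where
  "Omega v N = {x. vnorm v x \<le> resq v powi N}"

text \<open>Regularity need not be required: the underlying space is second countable, so it is
  automatic for a Borel measure that is finite on compact sets.\<close>

definition normalized_haar ::
  "('k::nonarch_local_field \<Rightarrow> real) \<Rightarrow> ('k ^ 'n) measure \<Rightarrow> bool" where
  "normalized_haar v M \<longleftrightarrow>
     sets M = sets borel \<and>
     (\<forall>a. \<forall>A\<in>sets M. emeasure M ((\<lambda>x. a + x) ` A) = emeasure M A) \<and>
     (\<forall>C. compact C \<longrightarrow> emeasure M C < \<infinity>) \<and>
     emeasure M {x. \<forall>i. x $ i \<in> int_ring v} = 1"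

definition vt_const :: "('k::nonarch_local_field \<Rightarrow> real) \<Rightarrow> nat \<Rightarrow> real \<Rightarrow> real" where
  "vt_const v n \<alpha> = (resq v powr \<alpha> - 1) / (1 - resq v powr (- \<alpha> - real n))"

definition vt_lambda ::
  "('k::nonarch_local_field \<Rightarrow> real) \<Rightarrow> ('k ^ 'n) measure \<Rightarrow> int \<Rightarrow> real \<Rightarrow> real" where
  "vt_lambda v M N \<alpha> = vt_const v CARD('n) \<alpha> *
     (LINT y:{y. vnorm v y > resq v powi N}|M. 1 / vnorm v y powr (real CARD('n) + \<alpha>))"

definition residue_space :: "('k::nonarch_local_field \<Rightarrow> real) \<Rightarrow> ('k set ^ 'n) set" where
  "residue_space v = {u. \<forall>i. u $ i \<in> residue_field v}"

definition reduce :: "('k::nonarch_local_field \<Rightarrow> real) \<Rightarrow> 'k ^ 'n \<Rightarrow> 'k set ^ 'n" where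
  "reduce v z = (\<chi> i. z $ i +o max_ideal v)"

definition nontrivial_character ::
  "('k::nonarch_local_field \<Rightarrow> real) \<Rightarrow> ('k set ^ 'n \<Rightarrow> complex) \<Rightarrow> bool" where
  "nontrivial_character v ch \<longleftrightarrow>
     (\<forall>u\<in>residue_space v. cmod (ch u) = 1) \<and>
     (\<forall>u\<in>residue_space v. \<forall>w\<in>residue_space v. ch (u + w) = ch u * ch w) \<and>
     (\<exists>u\<in>residue_space v. ch u \<noteq> 1)"

definition wavelet ::
  "('k::nonarch_local_field \<Rightarrow> real) \<Rightarrow> 'k \<Rightarrow> ('k ^ 'n) measure \<Rightarrow> 'k ^ 'n \<Rightarrow> int
    \<Rightarrow> ('k set ^ 'n \<Rightarrow> complex) \<Rightarrow> 'k ^ 'n \<Rightarrow> complex" where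
  "wavelet v \<beta> M a m ch x =
     (if x \<in> vball v a m
      then of_real (measure M (vball v a m) powr (- 1 / 2)) * ch (reduce v ((\<beta> powi m) *s (x - a)))
      else 0)"

definition center_choice ::
  "('k::nonarch_local_field \<Rightarrow> real) \<Rightarrow> int \<Rightarrow> (('k ^ 'n) set \<Rightarrow> 'k ^ 'n) \<Rightarrow> bool" where
  "center_choice v N ctr \<longleftrightarrow>
     (\<forall>a\<in>Omega v N. \<forall>m\<le>N.
        ctr (vball v a m) \<in> Omega v N \<and> vball v (ctr (vball v a m)) m = vball v a m)"

text \<open>The wavelets are collected as functions. A wavelet determines its supporting ball, hence
  the radius and the chosen center, and therefore its character on \<open>residue_space v\<close>; so
  summing over this set counts each pair of a ball and a nontrivial character exactly once.\<close>

definition wavelets ::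
  "('k::nonarch_local_field \<Rightarrow> real) \<Rightarrow> 'k \<Rightarrow> ('k ^ 'n) measure \<Rightarrow> (('k ^ 'n) set \<Rightarrow> 'k ^ 'n) \<Rightarrow> int
    \<Rightarrow> ('k ^ 'n \<Rightarrow> complex) set" where
  "wavelets v \<beta> M ctr N =
     {wavelet v \<beta> M (ctr (vball v a m)) m ch | a m ch.
        a \<in> Omega v N \<and> m \<le> N \<and> nontrivial_character v ch}"

text \<open>The set \<open>B\<close> below is the supporting ball of \<open>\<psi>\<close>; the value does not depend on the point
  of \<open>B\<close> that is selected.\<close>

definition vt_rho ::
  "('k::nonarch_local_field \<Rightarrow> real) \<Rightarrow> ('k ^ 'n) measure \<Rightarrow> int \<Rightarrow> real \<Rightarrow> ('k ^ 'n \<Rightarrow> complex)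
    \<Rightarrow> real" where
  "vt_rho v M N \<alpha> \<psi> =
     (let B = {x. \<psi> x \<noteq> 0}; x = (SOME x. x \<in> B) in
        vt_const v CARD('n) \<alpha> *
          ((LINT y:(Omega v N - B)|M. vnorm v (x - y) powr (- \<alpha> - real CARD('n)))
            + measure M B powr (- \<alpha> / real CARD('n))))"

definition H_kernel ::
  "('k::nonarch_local_field \<Rightarrow> real) \<Rightarrow> 'k \<Rightarrow> ('k ^ 'n) measure \<Rightarrow> (('k ^ 'n) set \<Rightarrow> 'k ^ 'n) \<Rightarrow> int
    \<Rightarrow> real \<Rightarrow> real \<Rightarrow> 'k ^ 'n \<Rightarrow> 'k ^ 'n \<Rightarrow> complex" where
  "H_kernel v \<beta> M ctr N \<alpha> t x y =
     of_real (1 / measure M (Omega v N :: ('k ^ 'n) set)) +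
     (\<Sum>\<^sub>\<infinity>\<psi>\<in>wavelets v \<beta> M ctr N. of_real (exp (- t * vt_rho v M N \<alpha> \<psi>)) * \<psi> x * cnj (\<psi> y))"

definition heat_kernel ::
  "('k::nonarch_local_field \<Rightarrow> real) \<Rightarrow> 'k \<Rightarrow> ('k ^ 'n) measure \<Rightarrow> (('k ^ 'n) set \<Rightarrow> 'k ^ 'n) \<Rightarrow> int
    \<Rightarrow> real \<Rightarrow> real \<Rightarrow> 'k ^ 'n \<Rightarrow> 'k ^ 'n \<Rightarrow> complex" where
  "heat_kernel v \<beta> M ctr N \<alpha> t x y =
     of_real (exp (- vt_lambda v M N \<alpha> * t)) * H_kernel v \<beta> M ctr N \<alpha> t x y"

end

theory Submission
  imports Defs
begin

text \<open>
  On the diagonal the kernel is a sum of non-negative terms, each of which is decreasing in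
  \<open>\<alpha>\<close>. With \<open>n\<close> the dimension and \<open>q\<close> the residue cardinality, a wavelet \<open>\<psi>\<close> supported on a ball
  of radius \<open>q powr m\<close> contributes
  \<open>exp (- t * (\<lambda> + \<rho>)) * \<bar>\<psi> x\<bar>\<^sup>2\<close>, where \<open>\<lambda>\<close> is the killing rate \<open>vt_lambda\<close> and \<open>\<rho>\<close> is \<open>vt_rho\<close>.

  The point is that \<open>\<lambda> + \<rho>\<close> has a far simpler form than either summand. Integrals of powers of
  the distance over shells telescope (\<open>shell_integral\<close>), since Haar measure scales by \<open>q powr n\<close> from
  one radius to the next (\<open>emeasure_vball\<close>), and the outcome is
  \<open>\<lambda> + \<rho> = q powr (\<alpha> * (1 - m))\<close> (\<open>eigenvalue\<close>). Because \<open>m \<le> N < 1\<close>, this increases with \<open>\<alpha>\<close>, so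
  every wavelet term decreases. The remaining term, from the constant function, is
  \<open>exp (- \<lambda> * t)\<close> divided by the volume of the ball; for \<open>N \<le> -1\<close> the rate
  \<open>\<lambda> = (1 - q powr (- n)) / (1 - q powr (- \<alpha> - n)) * q powr (- \<alpha> * N)\<close> is strictly increasing
  (\<open>vt_lambda_strict_mono\<close>), and this makes the inequality strict.

  The comparison of the infinite sums needs their convergence (\<open>diag_summable\<close>). A point lies in
  one ball of each radius, a ball carries only finitely many wavelets because a finite residue
  space has finitely many characters (\<open>finite_characters\<close>), and the sum over the radii is dominated
  by a geometric series (\<open>summable_radii\<close>).
\<close>

section \<open>The value group\<close>

locale normalized_field =
  fixes v :: "'k::nonarch_local_field \<Rightarrow> real" and \<beta> :: 'k
  assumes nav: "normalized_abs_val v" and unif: "uniformizer v \<beta>"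
begin

abbreviation q :: real where "q \<equiv> resq v"

lemma v_nonneg [simp]: "0 \<le> v x"
  and v_eq_0 [simp]: "v x = 0 \<longleftrightarrow> x = 0"
  and v_mult: "v (x * y) = v x * v y"
  and v_add_le: "v (x + y) \<le> max (v x) (v y)"
  and open_iff: "open S \<longleftrightarrow> (\<forall>x\<in>S. \<exists>e>0. {y. v (y - x) < e} \<subseteq> S)"
  using nav unfolding normalized_abs_val_def by auto

lemma v_zero [simp]: "v 0 = 0"
  by simp

lemma v_unif: "v \<beta> = 1 / q"
  using nav unif unfolding normalized_abs_val_def by auto

lemma v_one [simp]: "v 1 = 1"
proof -
  have "v 1 * v 1 = v 1" using v_mult[of 1 1] by simp
  moreover have "v 1 \<noteq> 0" by simp
  ultimately show ?thesis by simp
qed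

lemma v_minus [simp]: "v (- x) = v x"
proof -
  have "v (-1) * v (-1) = 1" using v_mult[of "-1" "-1"] by simp
  then have "v (-1) = 1" using v_nonneg[of "-1"]
    by (metis abs_of_nonneg real_sqrt_abs2 real_sqrt_one)
  then show ?thesis using v_mult[of "-1" x] by simp
qed

lemma v_minus_commute: "v (x - y) = v (y - x)"
  using v_minus[of "x - y"] by simp

text \<open>Non-discreteness supplies a non-zero element of the maximal ideal, so \<open>\<beta> \<noteq> 0\<close>. As
  \<open>v \<beta> = 1 / q\<close> with \<open>0 < v \<beta> < 1\<close>, the value \<open>q = 0\<close> that \<open>card\<close> would give for an infinite
  residue field is excluded, so the residue field is finite.\<close>

lemma q_gt_1: "1 < q"
proof -
  obtain S :: "'k set" where "\<not> open S" using nondiscrete by auto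
  then obtain x where "x \<in> S" and x: "\<forall>e>0. \<not> {y. v (y - x) < e} \<subseteq> S"
    unfolding open_iff by auto
  then obtain y where y: "v (y - x) < 1" "y \<notin> S"
    by (metis (mono_tags, lifting) mem_Collect_eq subsetI zero_less_one)
  then have "y - x \<in> max_ideal v" "y - x \<noteq> 0" using \<open>x \<in> S\<close> by (auto simp: max_ideal_def)
  then have "\<beta> \<noteq> 0" using unif unfolding uniformizer_def by auto
  then have "0 < v \<beta>" using v_nonneg[of \<beta>] v_eq_0[of \<beta>] by linarith
  moreover have "\<beta> \<in> max_ideal v"
    using unif unfolding uniformizer_def int_ring_def by (auto intro: image_eqI[of _ _ 1])
  then have "v \<beta> < 1" by (simp add: max_ideal_def)
  ultimately show ?thesis unfolding v_unif by (simp add: field_simps)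
qed

lemma q_pos [simp]: "0 < q" and q_nz [simp]: "q \<noteq> 0" and q_nonneg [simp]: "0 \<le> q"
  using q_gt_1 by auto

lemma q_ge_2: "2 \<le> q"
  using q_gt_1 unfolding resq_def by simp

lemma finite_residue_field: "finite (residue_field v)"
  using q_gt_1 unfolding resq_def by (metis card.infinite of_nat_0 not_one_less_zero)

lemma beta_nz [simp]: "\<beta> \<noteq> 0"
  using v_unif v_eq_0[of \<beta>] by (metis divide_eq_0_iff q_nz zero_neq_one)

lemma v_beta_powi: "v (\<beta> powi m) = q powr (- of_int m)"
proof -
  have pow: "v (x ^ k) = v x ^ k" for x k by (induction k) (simp_all add: v_mult)
  have "v (inverse x) = inverse (v x)" for x
  proof (cases "x = 0")
    case False
    then have "v x * v (inverse x) = 1" using v_mult[of x "inverse x"] by simp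
    then show ?thesis by (simp add: inverse_unique)
  qed simp
  then have "v (\<beta> powi m) = (1 / q) powi m"
    by (simp add: power_int_def pow v_unif)
  also have "\<dots> = q powr (- of_int m)"
    using q_pos by (simp add: powr_minus powr_real_of_int' power_int_inverse power_int_minus divide_inverse)
  finally show ?thesis .
qed

text \<open>Scaling by \<open>\<beta> powi m\<close> carries the two balls of radius \<open>q powr m\<close>, closed and open, to the ring of
  integers and to its maximal ideal.\<close>

lemma v_scale:
  "v (\<beta> powi m * x) \<le> 1 \<longleftrightarrow> v x \<le> q powr of_int m"
  "v (\<beta> powi m * x) < 1 \<longleftrightarrow> v x < q powr of_int m"
  by (simp_all add: v_mult v_beta_powi powr_minus divide_less_eq divide_le_eq
      flip: divide_inverse_commute)

lemma less_one_imp_le: "v x \<le> 1 / q" if "v x < 1"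
proof -
  from that obtain z where "x = \<beta> * z" "v z \<le> 1"
    using unif unfolding uniformizer_def max_ideal_def int_ring_def by blast
  then have "v x = v z / q" by (simp add: v_mult v_unif)
  with \<open>v z \<le> 1\<close> show ?thesis by (simp only: divide_right_mono[OF _ q_nonneg])
qed

text \<open>Multiplication by \<open>\<beta> powi m\<close> reduces this to the fact that no absolute value lies strictly
  between \<open>1 / q\<close> and \<open>1\<close>.\<close>

lemma v_less_iff: "v x < q powr of_int m \<longleftrightarrow> v x \<le> q powr of_int (m - 1)"
proof
  assume "v x < q powr of_int m"
  then have "v (\<beta> powi m * x) < 1"
    by (simp only: v_scale)
  then have "v (\<beta> powi m * x) \<le> 1 / q" by (rule less_one_imp_le)
  then show "v x \<le> q powr of_int (m - 1)" using q_pos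
    by (simp add: v_mult v_beta_powi powr_minus powr_diff field_simps)
next
  assume "v x \<le> q powr of_int (m - 1)"
  also have "\<dots> < q powr of_int m" using q_gt_1 by simp
  finally show "v x < q powr of_int m" .
qed

section \<open>Balls\<close>

lemma vnorm_le_iff: "vnorm v x \<le> r \<longleftrightarrow> (\<forall>i. v (x $ i) \<le> r)"
  unfolding vnorm_def by (subst Max_le_iff) auto

lemma vnorm_mem: "\<exists>i. vnorm v x = v (x $ i)"
  using Max_in[of "range (\<lambda>i. v (x $ i))"] unfolding vnorm_def by (simp add: image_iff)

lemma vnorm_minus_commute: "vnorm v (x - y) = vnorm v (y - x)"
  unfolding vnorm_def by (simp add: v_minus_commute)

lemma mem_vball: "x \<in> vball v a m \<longleftrightarrow> (\<forall>i. v (x $ i - a $ i) \<le> q powr of_int m)"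
  unfolding vball_def by (simp add: vnorm_le_iff powr_real_of_int')

lemma mem_vball_norm: "x \<in> vball v a m \<longleftrightarrow> vnorm v (x - a) \<le> q powr of_int m"
  unfolding vball_def by (simp add: powr_real_of_int')

lemma Omega_eq: "Omega v N = vball v 0 N"
  unfolding Omega_def vball_def by simp

lemma vball_center [simp]: "a \<in> vball v a m"
  by (simp add: mem_vball)

lemma vball_eq: "vball v b m = vball v a m" if "b \<in> vball v a m"
proof -
  have *: "vball v b m \<subseteq> vball v a m" if "b \<in> vball v a m" for a b :: "'k ^ 'n"
  proof
    fix x assume x: "x \<in> vball v b m"
    have "v (x $ i - a $ i) \<le> q powr of_int m" for i
      using v_add_le[of "x $ i - b $ i" "b $ i - a $ i"] that x unfolding mem_vball
      by (auto simp: le_max_iff_disj intro: order_trans)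
    then show "x \<in> vball v a m" by (simp add: mem_vball)
  qed
  have "a \<in> vball v b m" using that by (simp add: mem_vball v_minus_commute)
  with * that show ?thesis by blast
qed

lemma vball_mono: "vball v a m \<subseteq> vball v a m'" if "m \<le> m'"
proof -
  have "q powr of_int m \<le> q powr of_int m'" using that q_gt_1 by simp
  then show ?thesis unfolding subset_eq Ball_def mem_vball by (meson order_trans)
qed

lemma vnorm_sphere: "vnorm v (x - y) = q powr of_int m"
  if "y \<in> vball v x m" "y \<notin> vball v x (m - 1)"
proof -
  obtain i where i: "vnorm v (y - x) = v ((y - x) $ i)" using vnorm_mem by blast
  have "vnorm v (y - x) \<le> q powr of_int m" "\<not> vnorm v (y - x) \<le> q powr of_int (m - 1)"
    using that by (simp_all add: mem_vball_norm)
  then show ?thesis unfolding vnorm_minus_commute[of x y] i using v_less_iff[of "(y - x) $ i" m]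
    by linarith
qed

lemma open_vball: "open (vball v a m)"
proof -
  have "open {z. v (z - c) \<le> q powr of_int m}" for c
    unfolding open_iff
  proof (intro ballI exI[of _ "q powr of_int m"] conjI subsetI)
    fix x y assume "x \<in> {z. v (z - c) \<le> q powr of_int m}" "y \<in> {y. v (y - x) < q powr of_int m}"
    then show "y \<in> {z. v (z - c) \<le> q powr of_int m}"
      using v_add_le[of "y - x" "x - c"] by (auto simp: le_max_iff_disj intro: order_trans)
  qed simp
  then have "open ((\<lambda>x. x $ i) -` {z. v (z - a $ i) \<le> q powr of_int m})" for i
    by (rule open_vimage_vec_nth)
  then have "open (\<Inter>i. (\<lambda>x. x $ i) -` {z. v (z - a $ i) \<le> q powr of_int m})"
    by (intro open_INT) auto
  also have "(\<Inter>i. (\<lambda>x. x $ i) -` {z. v (z - a $ i) \<le> q powr of_int m}) = vball v a m"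
    by (auto simp: mem_vball)
  finally show ?thesis .
qed

section \<open>The residue space and its characters\<close>

lemma residue_eq_iff: "x +o max_ideal v = y +o max_ideal v \<longleftrightarrow> v (x - y) < 1"
proof -
  have *: "x +o max_ideal v \<subseteq> y +o max_ideal v" if "v (x - y) < 1" for x y
  proof
    fix z assume "z \<in> x +o max_ideal v"
    then have "v (z - x) < 1" by (auto simp: elt_set_plus_def max_ideal_def)
    with that have "v (z - y) < 1" using v_add_le[of "z - x" "x - y"] by auto
    then show "z \<in> y +o max_ideal v"
      by (auto simp: elt_set_plus_def max_ideal_def intro: exI[of _ "z - y"])
  qed
  have "x \<in> x +o max_ideal v" for x by (auto simp: elt_set_plus_def max_ideal_def)
  moreover have "v (x - y) < 1" if "x \<in> y +o max_ideal v"
    using that by (auto simp: elt_set_plus_def max_ideal_def)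
  moreover have "v (y - x) = v (x - y)" by (rule v_minus_commute)
  ultimately show ?thesis using *[of x y] *[of y x] by auto
qed

lemma residue_add: "x +o max_ideal v + (y +o max_ideal v) = (x + y) +o max_ideal v"
proof -
  have "max_ideal v + max_ideal v = max_ideal v"
  proof
    show "max_ideal v + max_ideal v \<subseteq> max_ideal v"
      using v_add_le by (fastforce simp: set_plus_def max_ideal_def less_max_iff_disj intro: le_less_trans)
    show "max_ideal v \<subseteq> max_ideal v + max_ideal v"
      by (force simp: set_plus_def max_ideal_def)
  qed
  then show ?thesis by (simp add: set_plus_rearrange)
qed

lemma residue_field_add: "a + b \<in> residue_field v"
  if ab: "a \<in> residue_field v" "b \<in> residue_field v"
proof -
  obtain x y where "a = x +o max_ideal v" "b = y +o max_ideal v" "v x \<le> 1" "v y \<le> 1"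
    using ab unfolding residue_field_def int_ring_def by auto
  moreover have "v (x + y) \<le> 1" using v_add_le[of x y] \<open>v x \<le> 1\<close> \<open>v y \<le> 1\<close> by linarith
  ultimately show ?thesis by (auto simp: residue_add residue_field_def int_ring_def)
qed

lemma residue_space_add: "u + w \<in> residue_space v"
  if "u \<in> residue_space v" "w \<in> residue_space v"
  using that residue_field_add unfolding residue_space_def by auto

lemma bij_residue_space:
  "bij_betw (\<lambda>u i. u $ i) (residue_space v :: ('k set ^ 'n) set)
     (PiE UNIV (\<lambda>_. residue_field v))"
  by (rule bij_betw_byWitness[where f' = vec_lambda])
    (auto simp: residue_space_def vec_lambda_eta)

lemma finite_residue_space: "finite (residue_space v :: ('k set ^ 'n) set)"
  using bij_betw_finite[OF bij_residue_space] finite_residue_field by (simp add: finite_PiE)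

lemma card_residue_space:
  "real (card (residue_space v :: ('k set ^ 'n) set)) = q ^ CARD('n)"
  using bij_betw_same_card[OF bij_residue_space] by (simp add: card_PiE resq_def)

text \<open>The powers of a value of a character are again values of it, and there are finitely many of
  them, so every value is a root of unity of bounded order.\<close>

lemma finite_characters:
  "finite ((\<lambda>ch. restrict ch (residue_space v)) `
     {ch :: 'k set ^ 'n \<Rightarrow> complex. nontrivial_character v ch})"
proof -
  let ?R = "residue_space v :: ('k set ^ 'n) set"
  let ?K = "card ?R"
  let ?Z = "\<Union>k\<in>{1..?K}. {z::complex. z ^ k = 1}"
  have mem: "ch u \<in> ?Z" if ch: "nontrivial_character v ch" and u: "u \<in> ?R" for ch u
  proof -
    have pow: "\<exists>w\<in>?R. ch w = ch u ^ Suc k" for k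
    proof (induction k)
      case (Suc k)
      then obtain w where w: "w \<in> ?R" "ch w = ch u ^ Suc k" by blast
      then have "ch (u + w) = ch u ^ Suc (Suc k)" "u + w \<in> ?R"
        using ch u residue_space_add unfolding nontrivial_character_def by auto
      then show ?case by blast
    qed (use u in auto)
    have sub: "(\<lambda>k. ch u ^ k) ` {1..Suc ?K} \<subseteq> ch ` ?R"
    proof (clarify)
      fix k assume k: "k \<in> {1..Suc ?K}"
      then obtain j where "k = Suc j" by (cases k) auto
      then show "ch u ^ k \<in> ch ` ?R" using pow[of j] by (metis image_eqI)
    qed
    have "\<not> inj_on (\<lambda>k. ch u ^ k) {1..Suc ?K}"
    proof
      assume "inj_on (\<lambda>k. ch u ^ k) {1..Suc ?K}"
      then have "card {1..Suc ?K} \<le> card (ch ` ?R)"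
        using sub finite_residue_space by (metis card_image card_mono finite_imageI)
      also have "\<dots> \<le> ?K" by (rule card_image_le[OF finite_residue_space])
      finally show False by simp
    qed
    then obtain i j where ij: "i \<in> {1..Suc ?K}" "j \<in> {1..Suc ?K}" "i < j" "ch u ^ i = ch u ^ j"
      unfolding inj_on_def by (metis linorder_neqE_nat)
    have "ch u \<noteq> 0" using ch u unfolding nontrivial_character_def by force
    moreover have "ch u ^ j = ch u ^ i * ch u ^ (j - i)"
      using power_add[of "ch u" i "j - i"] \<open>i < j\<close> by simp
    ultimately have "ch u ^ (j - i) = 1" using ij by auto
    then show ?thesis using ij by (intro UN_I[of "j - i"]) auto
  qed
  have "finite {z::complex. z ^ k = 1}" if "k \<in> {1..?K}" for k
    using that finite_roots_unity[of k, where 'a = complex] by auto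
  then have "finite (PiE ?R (\<lambda>_. ?Z))"
    by (intro finite_PiE finite_residue_space finite_UN_I) auto
  then show ?thesis by (rule rev_finite_subset) (use mem in fastforce)
qed

end

section \<open>Haar measure of balls and integrals over shells\<close>

locale haar_field = normalized_field v \<beta>
  for v :: "'k::nonarch_local_field \<Rightarrow> real" and \<beta> :: 'k +
  fixes M :: "('k ^ 'n) measure" and d :: real
  assumes haar: "normalized_haar v M" and d_eq: "d = real CARD('n)"
begin

lemma d_pos [simp]: "0 < d" and d_nz [simp]: "d \<noteq> 0"
  by (simp_all add: d_eq)

lemma sets_M [measurable_cong]: "sets M = sets borel"
  and emeasure_translate: "A \<in> sets M \<Longrightarrow> emeasure M ((\<lambda>x. a + x) ` A) = emeasure M A"
  and emeasure_unit: "emeasure M {x. \<forall>i. x $ i \<in> int_ring v} = 1"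
  using haar unfolding normalized_haar_def by auto

lemma vball_sets [measurable]: "vball v a m \<in> sets M"
  by (simp add: sets_M borel_open open_vball)

lemma emeasure_vball_0: "emeasure M (vball v a m) = emeasure M (vball v 0 m)"
proof -
  have "(\<lambda>x. a + x) ` vball v 0 m = vball v a m"
  proof (intro equalityI subsetI)
    fix x assume "x \<in> vball v a m"
    then have "x - a \<in> vball v 0 m" by (simp add: mem_vball)
    then show "x \<in> (\<lambda>x. a + x) ` vball v 0 m" by (intro image_eqI[of _ _ "x - a"]) auto
  qed (auto simp: mem_vball)
  then show ?thesis using emeasure_translate[OF vball_sets, of a 0 m] by simp
qed

lemma reduce_mem: "reduce v (\<beta> powi m *s (x - a)) \<in> residue_space v" if "x \<in> vball v a m"
proof -
  have "v (\<beta> powi m * (x $ i - a $ i)) \<le> 1" for i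
    using that unfolding mem_vball v_scale by simp
  then show ?thesis
    by (auto simp: residue_space_def reduce_def residue_field_def int_ring_def right_diff_distrib
        simp flip: vector_ssub_ldistrib)
qed

text \<open>The fibres over the residue space of reduction after scaling by \<open>\<beta> powi m\<close> are balls of the
  next smaller radius, and there are \<open>q ^ n\<close> of them.\<close>

lemma emeasure_vball_step:
  "emeasure M (vball v 0 m) = ennreal (q powr d) * emeasure M (vball v 0 (m - 1))"
proof -
  let ?R = "residue_space v :: ('k set ^ 'n) set"
  define F where "F u = {x \<in> vball v 0 m. reduce v (\<beta> powi m *s x) = u}" for u :: "'k set ^ 'n"
  have F: "\<exists>a. F u = vball v a (m - 1)" if u: "u \<in> ?R" for u
  proof -
    have "\<forall>i. \<exists>z. u $ i = z +o max_ideal v \<and> v z \<le> 1"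
      using u unfolding residue_space_def residue_field_def int_ring_def by auto
    then obtain z where z: "\<And>i. u $ i = z i +o max_ideal v" "\<And>i. v (z i) \<le> 1" by metis
    define a :: "'k ^ 'n" where "a = (\<chi> i. \<beta> powi (- m) * z i)"
    have beta_a: "\<beta> powi m * (a $ i) = z i" for i
      by (simp add: a_def power_int_minus field_simps)
    have red: "reduce v (\<beta> powi m *s x) = u \<longleftrightarrow> x \<in> vball v a (m - 1)" for x
    proof -
      have "reduce v (\<beta> powi m *s x) = u \<longleftrightarrow>
          (\<forall>i. \<beta> powi m * (x $ i) +o max_ideal v = \<beta> powi m * (a $ i) +o max_ideal v)"
        by (simp add: reduce_def vec_eq_iff z beta_a)
      also have "\<dots> \<longleftrightarrow> (\<forall>i. v (\<beta> powi m * (x $ i - a $ i)) < 1)"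
        by (simp only: residue_eq_iff right_diff_distrib)
      also have "\<dots> \<longleftrightarrow> (\<forall>i. v (x $ i - a $ i) < q powr of_int m)"
        by (simp only: v_scale)
      also have "\<dots> \<longleftrightarrow> x \<in> vball v a (m - 1)"
        unfolding v_less_iff mem_vball ..
      finally show ?thesis .
    qed
    have "v (a $ i) \<le> q powr of_int m" for i
      using z(2)[of i] by (simp add: a_def v_mult v_beta_powi)
    then have "a \<in> vball v 0 m" by (simp add: mem_vball)
    then have "vball v a (m - 1) \<subseteq> vball v 0 m"
      using vball_mono[of "m - 1" m a] vball_eq[of a 0 m] by simp
    then have "F u = vball v a (m - 1)" unfolding F_def red by auto
    then show ?thesis ..
  qed
  have "vball v 0 m = (\<Union>u\<in>?R. F u)"
    using reduce_mem[of _ 0 m] unfolding F_def by auto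
  then have "emeasure M (vball v 0 m) = emeasure M (\<Union>u\<in>?R. F u)" by (rule arg_cong)
  also have "\<dots> = (\<Sum>u\<in>?R. emeasure M (F u))"
  proof (rule sum_emeasure[symmetric, OF _ _ finite_residue_space])
    show "F ` ?R \<subseteq> sets M" using F vball_sets by force
    show "disjoint_family_on F ?R" by (auto simp: disjoint_family_on_def F_def)
  qed
  also have "\<dots> = (\<Sum>u\<in>?R. emeasure M (vball v 0 (m - 1)))"
    using F emeasure_vball_0 by (intro sum.cong refl) metis
  also have "\<dots> = ennreal (q powr d) * emeasure M (vball v 0 (m - 1))"
    by (simp add: powr_realpow d_eq flip: card_residue_space ennreal_of_nat_eq_real_of_nat)
  finally show ?thesis .
qed

lemma emeasure_vball: "emeasure M (vball v a m) = ennreal (q powr (d * of_int m))"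
proof -
  have "emeasure M (vball v 0 m) = ennreal (q powr (d * of_int m))"
  proof (induction m rule: int_induct[where k = 0])
    case base
    have "vball v 0 0 = {x :: 'k ^ 'n. \<forall>i. x $ i \<in> int_ring v}"
      by (auto simp: mem_vball int_ring_def)
    then show ?case using emeasure_unit by simp
  next
    case (step1 i)
    then show ?case using emeasure_vball_step[of "i + 1"]
      by (simp add: ennreal_mult'[symmetric] powr_add distrib_left mult.commute)
  next
    case (step2 i)
    have "ennreal (q powr d) * emeasure M (vball v 0 (i - 1)) =
        ennreal (q powr d) * ennreal (q powr (d * of_int (i - 1)))"
      using step2 emeasure_vball_step[of i]
      by (simp add: ennreal_mult'[symmetric] right_diff_distrib flip: powr_add)
    then show ?case by (simp add: ennreal_mult_cancel_left)
  qed
  then show ?thesis using emeasure_vball_0[of a m] by simp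
qed

lemma measure_vball: "measure M (vball v a m) = q powr (d * of_int m)"
  by (simp add: measure_def emeasure_vball)

text \<open>On a shell between consecutive radii the integrand is constant.\<close>

lemma shell_integral_step:
  "set_integrable M (vball v x m - vball v x (m - 1)) (\<lambda>y. vnorm v (x - y) powr (- s - d))"
  "(LINT y:(vball v x m - vball v x (m - 1))|M. vnorm v (x - y) powr (- s - d)) =
     (1 - q powr (- d)) * q powr (- s * of_int m)"
proof -
  let ?S = "vball v x m - vball v x (m - 1)"
  let ?c = "(q powr of_int m) powr (- s - d)"
  have S: "?S \<in> sets M" "emeasure M ?S < \<infinity>"
    using emeasure_mono[of ?S "vball v x m" M] by (auto simp: emeasure_vball intro: le_less_trans)
  have eq: "vnorm v (x - y) powr (- s - d) = ?c" if "y \<in> ?S" for y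
    using that vnorm_sphere[of y x m] by simp
  have "set_integrable M ?S (\<lambda>_. ?c)"
    using S unfolding set_integrable_def by (intro integrable_mult_right integrable_scaleR_left integrable_real_indicator)
  then show "set_integrable M ?S (\<lambda>y. vnorm v (x - y) powr (- s - d))"
    by (subst set_integrable_cong[OF refl refl eq])
  have "(LINT y:?S|M. vnorm v (x - y) powr (- s - d)) = (LINT y:?S|M. ?c)"
    using S eq by (intro set_lebesgue_integral_cong) auto
  also have "\<dots> = measure M ?S * ?c"
    using S by (subst set_integral_const) auto
  also have "measure M ?S = q powr (d * of_int m) - q powr (d * of_int (m - 1))"
    by (subst measure_Diff) (auto simp: emeasure_vball measure_vball vball_mono)
  also have "\<dots> = q powr (d * of_int m) * (1 - q powr (- d))"
    by (simp add: right_diff_distrib powr_diff powr_minus divide_inverse)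
  also have "\<dots> * ?c = (1 - q powr (- d)) * (q powr (d * of_int m) * q powr (of_int m * (- s - d)))"
    by (simp add: powr_powr)
  also have "q powr (d * of_int m) * q powr (of_int m * (- s - d)) = q powr (- s * of_int m)"
    by (simp add: algebra_simps flip: powr_add)
  finally show "(LINT y:?S|M. vnorm v (x - y) powr (- s - d)) =
     (1 - q powr (- d)) * q powr (- s * of_int m)" .
qed

lemma shell_integral:
  fixes k :: nat
  assumes s: "0 < s"
  shows "set_integrable M (vball v x (m + int k) - vball v x m) (\<lambda>y. vnorm v (x - y) powr (- s - d)) \<and>
    (LINT y:(vball v x (m + int k) - vball v x m)|M. vnorm v (x - y) powr (- s - d)) =
      (1 - q powr (- d)) / (q powr s - 1) * (q powr (- s * of_int m) - q powr (- s * of_int (m + int k)))"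
    (is "?I k \<and> ?L k = ?r k")
proof (induction k)
  case 0
  show ?case by (simp add: set_integrable_def set_lebesgue_integral_def)
next
  case (Suc k)
  let ?A = "vball v x (m + int k) - vball v x m"
  let ?S = "vball v x (m + int (Suc k)) - vball v x (m + int (Suc k) - 1)"
  have un: "vball v x (m + int (Suc k)) - vball v x m = ?A \<union> ?S"
    using vball_mono[of "m + int k" "m + int (Suc k)" x] vball_mono[of m "m + int k" x]
    by (auto simp: add.assoc)
  have q1: "q powr s - 1 > 0" using s q_gt_1 by simp
  note step = shell_integral_step[of x "m + int (Suc k)" s]
  have "?I (Suc k)"
    unfolding un using Suc step(1) by (intro set_integrable_Un) auto
  moreover have "?L (Suc k) = ?r k + (1 - q powr (- d)) * q powr (- s * of_int (m + int (Suc k)))"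
    unfolding un using Suc step by (subst set_integral_Un) auto
  moreover have "?r k + (1 - q powr (- d)) * q powr (- s * of_int (m + int (Suc k))) = ?r (Suc k)"
  proof -
    have telescope: "C / (Q - 1) * (u - Q * w) + C * w = C / (Q - 1) * (u - w)"
      if "Q - 1 > 0" for C Q u w :: real
      using that by (simp add: field_simps)
    have "q powr (- s * of_int (m + int k)) = q powr s * q powr (- s * of_int (m + int (Suc k)))"
      by (simp add: algebra_simps flip: powr_add)
    then show ?thesis by (simp only: telescope[OF q1])
  qed
  ultimately show ?case by (simp only:)
qed

section \<open>The eigenvalues\<close>

lemma vt_const_eq: "vt_const v CARD('n) s = (q powr s - 1) / (1 - q powr (- s - d))"
  by (simp add: vt_const_def d_eq)

text \<open>The outer region is exhausted by the finite unions of shells treated in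
  \<open>shell_integral\<close>, so monotone convergence turns the closed form there into its limit.\<close>

lemma vt_lambda_eq:
  assumes s: "0 < s"
  shows "vt_lambda v M N s = (1 - q powr (- d)) / (1 - q powr (- s - d)) * q powr (- s * of_int N)"
proof -
  let ?S = "\<lambda>k::nat. vball v (0 :: 'k ^ 'n) (N + int k) - vball v 0 N"
  let ?D = "(1 - q powr (- d)) / (q powr s - 1)"
  let ?f = "\<lambda>y::'k ^ 'n. vnorm v (0 - y) powr (- s - d)"
  let ?E = "{y::'k ^ 'n. vnorm v y > q powi N}"
  note shell = shell_integral[OF s, of 0 N]
  have "mono (\<lambda>k. indicator (?S k) y *\<^sub>R ?f y)" for y
  proof (intro monoI scaleR_right_mono)
    fix k l :: nat assume "k \<le> l"
    then have "?S k \<subseteq> ?S l"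
      using vball_mono[of "N + int k" "N + int l" "0 :: 'k ^ 'n"] by (intro Diff_mono) auto
    then show "indicator (?S k) y \<le> (indicator (?S l) y :: real)"
      by (auto simp: indicator_def)
  qed simp
  moreover have lim: "(\<lambda>k. indicator (?S k) y *\<^sub>R ?f y) \<longlonglongrightarrow> indicator ?E y *\<^sub>R ?f y" for y
  proof -
    obtain K :: nat where K: "vnorm v y / q powr of_int N < q ^ K"
      using real_arch_pow[OF q_gt_1] by blast
    have "indicator (?S k) y = (indicator ?E y :: real)" if "K \<le> k" for k
    proof -
      have "vnorm v y < q powr of_int N * q ^ K"
        using K by (simp add: field_simps)
      also have "\<dots> \<le> q powr of_int N * q ^ k"
        using that q_gt_1 by (intro mult_left_mono power_increasing) auto
      also have "\<dots> = q powr of_int (N + int k)"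
        by (simp add: powr_add powr_realpow)
      finally show ?thesis
        by (auto simp: indicator_def mem_vball_norm powr_real_of_int')
    qed
    then show ?thesis by (intro tendsto_eventually) (auto simp: eventually_sequentially)
  qed
  moreover have "(\<lambda>k. integral\<^sup>L M (\<lambda>y. indicator (?S k) y *\<^sub>R ?f y)) \<longlonglongrightarrow> ?D * q powr (- s * of_int N)"
  proof -
    have "(\<lambda>k. ?D * (q powr (- s * of_int N) - q powr (- s * of_int N) * (q powr (- s)) ^ k))
        \<longlonglongrightarrow> ?D * (q powr (- s * of_int N) - q powr (- s * of_int N) * 0)"
      using s q_gt_1 powr_less_one[of q "- s"] by (intro tendsto_intros LIMSEQ_realpow_zero) auto
    moreover have "q powr (- s * of_int (N + int k)) = q powr (- s * of_int N) * (q powr (- s)) ^ k" for k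
      by (simp add: algebra_simps powr_power flip: powr_add)
    ultimately show ?thesis using shell unfolding set_lebesgue_integral_def by simp
  qed
  moreover have int: "integrable M (\<lambda>y. indicator (?S k) y *\<^sub>R ?f y)" for k
    using shell unfolding set_integrable_def by blast
  moreover have "(\<lambda>y. indicator ?E y *\<^sub>R ?f y) \<in> borel_measurable M"
    by (rule borel_measurable_LIMSEQ_real[OF lim borel_measurable_integrable[OF int]])
  ultimately have "(LINT y:?E|M. ?f y) = ?D * q powr (- s * of_int N)"
    unfolding set_lebesgue_integral_def
    by (intro integral_monotone_convergence[where f = "\<lambda>k y. indicator (?S k) y *\<^sub>R ?f y"] AE_I2)
  moreover have "?f y = 1 / vnorm v y powr (d + s)" for y
  proof -
    have "- s - d = - (d + s)" by simp
    then show ?thesis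
      unfolding vnorm_minus_commute[of 0 y] by (simp only: powr_minus_divide diff_zero)
  qed
  moreover have "q powr s - 1 > 0" using s q_gt_1 by simp
  ultimately show ?thesis unfolding vt_lambda_def vt_const_eq d_eq[symmetric] by simp
qed

lemma wavelet_norm:
  assumes ch: "nontrivial_character v ch"
  shows "cmod (wavelet v \<beta> M a m ch x) = (if x \<in> vball v a m then q powr (- d * of_int m / 2) else 0)"
proof (cases "x \<in> vball v a m")
  case True
  have "cmod (ch (reduce v (\<beta> powi m *s (x - a)))) = 1"
    using ch reduce_mem[OF True] unfolding nontrivial_character_def by blast
  then have "cmod (wavelet v \<beta> M a m ch x) = (q powr (d * of_int m)) powr (- 1 / 2)"
    using True unfolding wavelet_def measure_vball by (simp add: norm_mult del: powr_powr)
  then show ?thesis using True unfolding powr_powr by simp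
qed (simp add: wavelet_def)

lemma wavelet_support:
  assumes ch: "nontrivial_character v ch"
  shows "{x. wavelet v \<beta> M a m ch x \<noteq> 0} = vball v a m"
proof -
  have "wavelet v \<beta> M a m ch x \<noteq> 0 \<longleftrightarrow> x \<in> vball v a m" for x
    using wavelet_norm[OF ch, of a m x] norm_eq_zero[of "wavelet v \<beta> M a m ch x"]
    by (cases "x \<in> vball v a m") auto
  then show ?thesis by blast
qed

lemma wavelet_restrict:
  "wavelet v \<beta> M a m (restrict ch (residue_space v)) = wavelet v \<beta> M a m ch"
proof
  show "wavelet v \<beta> M a m (restrict ch (residue_space v)) x = wavelet v \<beta> M a m ch x" for x
    using reduce_mem[of x a m] by (cases "x \<in> vball v a m")
      (simp_all only: wavelet_def restrict_apply if_True if_False simp_thms)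
qed

text \<open>The killing term \<open>vt_lambda\<close> is the part of the integral over the complement of \<open>B\<close> that
  lies outside \<open>\<Omega>\<close>; adding it removes the dependence on \<open>N\<close> and leaves the eigenvalue of the
  operator on the whole space.\<close>

lemma eigenvalue:
  assumes s: "0 < s" and ch: "nontrivial_character v ch" and b: "b \<in> Omega v N" and m: "m \<le> N"
  shows "vt_lambda v M N s + vt_rho v M N s (wavelet v \<beta> M b m ch) = q powr (s * (1 - of_int m))"
proof -
  let ?B = "vball v b m"
  define x where "x = (SOME x. x \<in> ?B)"
  have x: "x \<in> ?B" unfolding x_def by (rule someI[of _ b]) simp
  have Bx: "?B = vball v x m" using vball_eq[OF x] by simp
  have "x \<in> vball v b N" using x vball_mono[OF m] by auto
  then have Om: "Omega v N = vball v x N"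
    using vball_eq[of x b N] vball_eq[of b 0 N] b unfolding Omega_eq by simp
  let ?D = "(1 - q powr (- d)) / (q powr s - 1)"
  have "(LINT y:(Omega v N - ?B)|M. vnorm v (x - y) powr (- s - d)) =
      ?D * (q powr (- s * of_int m) - q powr (- s * of_int N))"
    using shell_integral[OF s, of x m "nat (N - m)"] m unfolding Om Bx by simp
  moreover have "measure M ?B powr (- s / d) = q powr (- s * of_int m)"
    by (simp add: measure_vball powr_powr mult.commute)
  ultimately have rho: "vt_rho v M N s (wavelet v \<beta> M b m ch) = vt_const v CARD('n) s *
      (?D * (q powr (- s * of_int m) - q powr (- s * of_int N)) + q powr (- s * of_int m))"
    unfolding vt_rho_def Let_def d_eq[symmetric] wavelet_support[OF ch] x_def[symmetric] by simp
  have a: "q powr s - 1 > 0" using s q_gt_1 by simp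
  have "q powr (- s - d) < 1" using s q_gt_1 d_pos by (intro powr_less_one) linarith+
  then have c: "1 - q powr (- s - d) > 0" by simp
  have "vt_lambda v M N s = vt_const v CARD('n) s * (?D * q powr (- s * of_int N))"
    unfolding vt_lambda_eq[OF s] vt_const_eq using a by simp
  then have "vt_lambda v M N s + vt_rho v M N s (wavelet v \<beta> M b m ch) =
      vt_const v CARD('n) s * (?D + 1) * q powr (- s * of_int m)"
    unfolding rho by (simp add: algebra_simps)
  also have "?D + 1 = q powr s * (1 - q powr (- s - d)) / (q powr s - 1)"
    using a by (simp add: field_simps flip: powr_add)
  also have "vt_const v CARD('n) s * \<dots> * q powr (- s * of_int m) = q powr s * q powr (- s * of_int m)"
    unfolding vt_const_eq using a c by simp
  also have "\<dots> = q powr (s * (1 - of_int m))"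
    by (simp add: algebra_simps flip: powr_add)
  finally show ?thesis .
qed

text \<open>As \<open>N \<le> -1\<close>, one factor \<open>q powr s\<close> can be split off from \<open>q powr (- s * N)\<close> so that the
  remaining power is still non-decreasing in \<open>s\<close>. That factor compensates the decrease of
  \<open>1 / (1 - q powr (- s - d))\<close>.\<close>

lemma vt_lambda_strict_mono:
  assumes s: "1 \<le> s" and st: "s < t" and N: "N \<le> -1"
  shows "vt_lambda v M N s < vt_lambda v M N t"
proof -
  define a where "a = q powr s"
  define b where "b = q powr t"
  define c where "c = q powr (- d)"
  have ab: "a < b" unfolding a_def b_def using st q_gt_1 by simp
  have "q powr 1 \<le> a" unfolding a_def using s q_gt_1 by (intro powr_mono) auto
  then have a2: "2 \<le> a" using q_ge_2 by simp
  have c: "0 < c" "c < 1" unfolding c_def using q_gt_1 by (auto intro: powr_less_one)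
  have form: "vt_lambda v M N r = (1 - c) * (q powr r / (1 - c / q powr r)) * q powr (r * of_int (- N - 1))"
    if "1 \<le> r" for r
  proof -
    have "q powr (- r - d) = c / q powr r"
      by (simp add: c_def powr_minus divide_inverse powr_diff mult.commute)
    moreover have "q powr (- r * of_int N) = q powr r * q powr (r * of_int (- N - 1))"
      by (simp add: algebra_simps flip: powr_add)
    ultimately show ?thesis using that by (simp add: vt_lambda_eq c_def)
  qed
  \<comment> \<open>For \<open>2 \<le> a < b\<close> and \<open>0 < c < 1\<close>, the inequality \<open>a / (1 - c / a) < b / (1 - c / b)\<close> amounts to
    \<open>c * (a + b) < a * b\<close>.\<close>
  have "0 \<le> (a - 2) * (b - 2) + (a - 2) + (b - 2)"
    using a2 ab by (intro add_nonneg_nonneg mult_nonneg_nonneg) auto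
  then have "a + b \<le> a * b" by (simp add: algebra_simps)
  moreover have "c * (a + b) < 1 * (a + b)" using a2 ab c by (intro mult_strict_right_mono) auto
  ultimately have "c * (a + b) < a * b" by simp
  then have "c * (a + b) * (b - a) < a * b * (b - a)"
    using ab by (intro mult_strict_right_mono) auto
  then have "a * a * (b - c) < b * b * (a - c)" by (simp add: algebra_simps)
  then have "a / (1 - c / a) < b / (1 - c / b)"
    using a2 ab c by (simp add: divide_simps)
  then have "(1 - c) * (a / (1 - c / a)) < (1 - c) * (b / (1 - c / b))"
    using c by (intro mult_strict_left_mono) auto
  moreover have "q powr (s * of_int (- N - 1)) \<le> q powr (t * of_int (- N - 1))"
    using st N q_gt_1 by (intro powr_mono mult_right_mono) auto
  moreover have "0 \<le> (1 - c) * (a / (1 - c / a))" using a2 c by (simp add: divide_simps)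
  moreover have "0 < q powr (s * of_int (- N - 1))" using q_pos by simp
  ultimately have "(1 - c) * (a / (1 - c / a)) * q powr (s * of_int (- N - 1)) <
      (1 - c) * (b / (1 - c / b)) * q powr (t * of_int (- N - 1))"
    by (rule mult_less_le_imp_less)
  then show ?thesis using s st by (simp only: form a_def b_def)
qed

section \<open>The kernel on the diagonal\<close>

lemma wavelets_cases:
  assumes "\<psi> \<in> wavelets v \<beta> M ctr N" "center_choice v N ctr"
  obtains b m ch where "b \<in> Omega v N" "m \<le> N" "nontrivial_character v ch"
    "\<psi> = wavelet v \<beta> M b m ch"
proof -
  obtain a m ch where *: "\<psi> = wavelet v \<beta> M (ctr (vball v a m)) m ch"
    "a \<in> Omega v N" "m \<le> N" "nontrivial_character v ch"
    using assms(1) unfolding wavelets_def by blast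
  moreover have "ctr (vball v a m) \<in> Omega v N"
    using assms(2) *(2,3) unfolding center_choice_def by simp
  ultimately show thesis using that by simp
qed

text \<open>\<open>nontrivial_character\<close> leaves the values outside the residue space arbitrary, so only the
  restrictions form a finite set; they yield the same wavelets by \<open>wavelet_restrict\<close>.\<close>

definition chars :: "('k set ^ 'n \<Rightarrow> complex) set" where
  "chars = (\<lambda>ch. restrict ch (residue_space v)) ` {ch. nontrivial_character v ch}"

text \<open>A ball containing \<open>x\<close> is determined by its radius, and the chosen center by the ball; so a
  wavelet that does not vanish at \<open>x\<close> is given by a radius and a character.\<close>

lemma wavelets_at_point:
  assumes ctr: "center_choice v N ctr" and x: "x \<in> Omega v N"
    and psi: "\<psi> \<in> wavelets v \<beta> M ctr N" "\<psi> x \<noteq> 0"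
  shows "\<psi> \<in> (\<lambda>(m, ch). wavelet v \<beta> M (ctr (vball v x m)) m ch) ` ({..N} \<times> chars)"
proof -
  obtain a m ch where *: "a \<in> Omega v N" "m \<le> N" "nontrivial_character v ch"
    "\<psi> = wavelet v \<beta> M (ctr (vball v a m)) m ch"
    using psi(1) unfolding wavelets_def by blast
  have "x \<in> vball v (ctr (vball v a m)) m"
    using psi(2) wavelet_support[OF *(3)] * by blast
  then have "x \<in> vball v a m" using ctr * unfolding center_choice_def by simp
  then have "vball v a m = vball v x m" using vball_eq[of x a m] by simp
  then have "\<psi> = wavelet v \<beta> M (ctr (vball v x m)) m (restrict ch (residue_space v))"
    using * by (simp add: wavelet_restrict)
  moreover have "restrict ch (residue_space v) \<in> chars" using *(3) unfolding chars_def by blast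
  ultimately show ?thesis using *(2) by (intro image_eqI[of _ _ "(m, restrict ch (residue_space v))"]) auto
qed

lemma chars_wavelet:
  assumes ctr: "center_choice v N ctr" and x: "x \<in> Omega v N" and m: "m \<le> N" and c: "c \<in> chars"
    and s: "0 < s"
  defines "\<psi> \<equiv> wavelet v \<beta> M (ctr (vball v x m)) m c"
  shows "vt_lambda v M N s + vt_rho v M N s \<psi> = q powr (s * (1 - of_int m))"
    and "(cmod (\<psi> x))\<^sup>2 = q powr (- d * of_int m)"
proof -
  obtain ch where ch: "nontrivial_character v ch" "c = restrict ch (residue_space v)"
    using c unfolding chars_def by auto
  have b: "ctr (vball v x m) \<in> Omega v N" "vball v (ctr (vball v x m)) m = vball v x m"
    using ctr x m unfolding center_choice_def by auto
  have psi: "\<psi> = wavelet v \<beta> M (ctr (vball v x m)) m ch"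
    unfolding \<psi>_def ch(2) wavelet_restrict ..
  show "vt_lambda v M N s + vt_rho v M N s \<psi> = q powr (s * (1 - of_int m))"
    unfolding psi using s ch(1) b(1) m by (rule eigenvalue)
  show "(cmod (\<psi> x))\<^sup>2 = q powr (- d * of_int m)"
    unfolding psi wavelet_norm[OF ch(1)] b(2) by (simp add: power2_eq_square flip: powr_add)
qed

lemma summable_radii:
  assumes s: "d < s" and t: "0 < t"
  shows "(\<lambda>m. exp (- t * q powr (s * (1 - of_int m))) * q powr (- d * of_int m)) summable_on {..N::int}"
    (is "?h summable_on _")
proof -
  \<comment> \<open>Already \<open>exp (- y) \<le> 1 / y\<close> gives a geometric series, as \<open>s > d\<close>.\<close>
  have le: "?h (N - int k) \<le> q powr ((s - d) * of_int N - s) / t * (q powr (d - s)) ^ k" for k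
  proof -
    let ?y = "t * q powr (s * (1 - of_int (N - int k)))"
    have y: "0 < ?y" using t by simp
    have "?y \<le> exp ?y" using exp_ge_add_one_self[of ?y] by linarith
    then have "exp (- ?y) \<le> 1 / ?y" using y by (simp add: exp_minus field_simps)
    then have "?h (N - int k) \<le> 1 / ?y * q powr (- d * of_int (N - int k))"
      by (intro mult_right_mono) auto
    also have "\<dots> = q powr (- d * of_int (N - int k) - s * (1 - of_int (N - int k))) / t"
      by (simp only: powr_diff) simp
    also have "- d * of_int (N - int k) - s * (1 - of_int (N - int k)) =
        (s - d) * of_int N - s + (d - s) * real k"
      by (simp add: algebra_simps)
    also have "q powr \<dots> = q powr ((s - d) * of_int N - s) * (q powr (d - s)) ^ k"
      by (simp add: powr_add powr_power mult.commute)
    finally show ?thesis by simp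
  qed
  have "summable (\<lambda>k. q powr ((s - d) * of_int N - s) / t * (q powr (d - s)) ^ k)"
    using s q_gt_1 powr_less_one[of q "d - s"] by (intro summable_mult summable_geometric) auto
  then have "summable (\<lambda>k. ?h (N - int k))"
    by (rule summable_comparison_test') (use le in auto)
  then have "(?h \<circ> (\<lambda>k. N - int k)) summable_on UNIV"
    by (subst summable_on_UNIV_nonneg_real_iff) (auto simp: o_def)
  moreover have "inj (\<lambda>k. N - int k)" by (auto simp: inj_on_def)
  moreover have "range (\<lambda>k. N - int k) = {..N}"
  proof (intro equalityI subsetI)
    fix m assume "m \<in> {..N}"
    then show "m \<in> range (\<lambda>k. N - int k)" by (intro image_eqI[of _ _ "nat (N - m)"]) auto
  qed auto
  ultimately show ?thesis using summable_on_reindex[of "\<lambda>k. N - int k" UNIV ?h] by simp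
qed

text \<open>The diagonal summand of the kernel with the factor \<open>exp (- vt_lambda * t)\<close> moved into the sum:
  the exponent is then the full eigenvalue, which is monotone in \<open>s\<close>.\<close>

definition diag_term :: "int \<Rightarrow> real \<Rightarrow> real \<Rightarrow> 'k ^ 'n \<Rightarrow> ('k ^ 'n \<Rightarrow> complex) \<Rightarrow> real" where
  "diag_term N s t x \<psi> = exp (- t * (vt_lambda v M N s + vt_rho v M N s \<psi>)) * (cmod (\<psi> x))\<^sup>2"

text \<open>Only finitely many wavelets of each radius are non-zero at a given point, so the sum is
  dominated by a multiple of the sum over the radii.\<close>

lemma diag_summable:
  assumes ctr: "center_choice v N ctr" and x: "x \<in> Omega v N" and s: "d < s" and t: "0 < t"
  shows "diag_term N s t x summable_on wavelets v \<beta> M ctr N"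
proof -
  let ?w = "\<lambda>(m, c). wavelet v \<beta> M (ctr (vball v x m)) m c"
  let ?h = "\<lambda>m. exp (- t * q powr (s * (1 - of_int m))) * q powr (- d * of_int m)"
  let ?W = "{\<psi> \<in> wavelets v \<beta> M ctr N. \<psi> x \<noteq> 0}"
  have s0: "0 < s" using s d_pos by linarith
  have fin: "finite chars" unfolding chars_def by (rule finite_characters)
  have val: "diag_term N s t x (?w (m, c)) = ?h m" if "m \<le> N" "c \<in> chars" for m c
    using chars_wavelet[OF ctr x that s0] by (simp add: diag_term_def)
  have "(\<lambda>m. real (card chars) * ?h m) summable_on {..N}"
    by (intro summable_on_cmult_right summable_radii s t)
  then have "(\<lambda>p. ?h (fst p)) summable_on ({..N} \<times> chars)"
    using fin by (intro summable_on_SigmaI[where g = "\<lambda>m. real (card chars) * ?h m"])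
      (auto intro!: has_sum_finiteI)
  then have big: "(diag_term N s t x \<circ> ?w) summable_on ({..N} \<times> chars)"
    by (rule summable_on_cong[THEN iffD1, rotated]) (auto simp: val[simplified])
  have "?W \<subseteq> ?w ` ({..N} \<times> chars)" using wavelets_at_point[OF ctr x] by auto
  then obtain U where U: "U \<subseteq> {..N} \<times> chars" "inj_on ?w U" "?W = ?w ` U"
    unfolding subset_image_inj by auto
  have "(diag_term N s t x \<circ> ?w) summable_on U"
    by (rule summable_on_subset_banach[OF big U(1)])
  then have "diag_term N s t x summable_on ?W"
    unfolding U(3) summable_on_reindex[OF U(2)] .
  then show ?thesis
    by (rule summable_on_cong_neutral[THEN iffD1, rotated -1]) (auto simp: diag_term_def)
qed

lemma heat_kernel_diag:
  assumes "center_choice v N ctr" "x \<in> Omega v N" "d < s" "0 < t"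
  shows "heat_kernel v \<beta> M ctr N s t x x =
     of_real (exp (- vt_lambda v M N s * t) * q powr (- d * of_int N) +
       (\<Sum>\<^sub>\<infinity>\<psi>\<in>wavelets v \<beta> M ctr N. diag_term N s t x \<psi>))"
proof -
  let ?e = "complex_of_real (exp (- vt_lambda v M N s * t))"
  have "?e * (\<Sum>\<^sub>\<infinity>\<psi>\<in>wavelets v \<beta> M ctr N.
        of_real (exp (- t * vt_rho v M N s \<psi>)) * \<psi> x * cnj (\<psi> x)) =
      (\<Sum>\<^sub>\<infinity>\<psi>\<in>wavelets v \<beta> M ctr N. of_real (diag_term N s t x \<psi>))"
    unfolding infsum_cmult_right'[symmetric]
  proof (intro infsum_cong)
    fix \<psi> :: "'k ^ 'n \<Rightarrow> complex"
    have "?e * (of_real (exp (- t * vt_rho v M N s \<psi>)) * \<psi> x * cnj (\<psi> x)) =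
        of_real (exp (- vt_lambda v M N s * t) * exp (- t * vt_rho v M N s \<psi>)) * (\<psi> x * cnj (\<psi> x))"
      by simp
    also have "\<dots> = of_real (diag_term N s t x \<psi>)"
      by (simp add: diag_term_def complex_norm_square algebra_simps flip: exp_add of_real_power)
    finally show "?e * (of_real (exp (- t * vt_rho v M N s \<psi>)) * \<psi> x * cnj (\<psi> x)) =
      of_real (diag_term N s t x \<psi>)" .
  qed
  moreover have "1 / measure M (Omega v N) = q powr (- d * of_int N)"
    by (simp add: Omega_eq measure_vball powr_minus_divide)
  moreover have "(\<Sum>\<^sub>\<infinity>\<psi>\<in>wavelets v \<beta> M ctr N. complex_of_real (diag_term N s t x \<psi>)) =
      of_real (infsum (diag_term N s t x) (wavelets v \<beta> M ctr N))"
    using has_sum_of_real[OF has_sum_infsum[OF diag_summable[OF assms]]] by (rule infsumI)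
  ultimately show ?thesis
    unfolding heat_kernel_def H_kernel_def by (simp add: distrib_left)
qed

lemma diag_term_antimono:
  assumes "\<psi> \<in> wavelets v \<beta> M ctr N" "center_choice v N ctr" and N: "N \<le> -1"
    and s: "0 < s" "s \<le> s'" and t: "0 < t"
  shows "diag_term N s' t x \<psi> \<le> diag_term N s t x \<psi>"
proof -
  obtain b m ch where *: "b \<in> Omega v N" "m \<le> N" "nontrivial_character v ch"
    "\<psi> = wavelet v \<beta> M b m ch"
    using wavelets_cases[OF assms(1,2)] .
  have "q powr (s * (1 - of_int m)) \<le> q powr (s' * (1 - of_int m))"
    using * N s q_gt_1 by (intro powr_mono mult_right_mono) auto
  then have "vt_lambda v M N s + vt_rho v M N s \<psi> \<le> vt_lambda v M N s' + vt_rho v M N s' \<psi>"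
    using eigenvalue[OF _ *(3,1,2)] *(4) s by simp
  then show ?thesis using t unfolding diag_term_def by (intro mult_right_mono) auto
qed

end

section \<open>Monotonicity in the order of the operator\<close>

theorem mainTheorem1:
  fixes v :: "'k::nonarch_local_field \<Rightarrow> real"
    and \<beta> :: 'k
    and M :: "('k ^ 'n) measure"
    and ctr :: "('k ^ 'n) set \<Rightarrow> 'k ^ 'n"
    and N :: int
    and \<alpha>\<^sub>0 \<alpha>\<^sub>1 :: real
  assumes "normalized_abs_val v"
    and "uniformizer v \<beta>"
    and "normalized_haar v M"
    and "N \<le> -1"
    and "center_choice v N ctr"
    and "real CARD('n) < \<alpha>\<^sub>0" and "\<alpha>\<^sub>0 < \<alpha>\<^sub>1"
  shows "\<forall>t>0. \<forall>x\<in>Omega v N.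
           heat_kernel v \<beta> M ctr N \<alpha>\<^sub>0 t x x \<in> \<real> \<and>
           heat_kernel v \<beta> M ctr N \<alpha>\<^sub>1 t x x \<in> \<real> \<and>
           Re (heat_kernel v \<beta> M ctr N \<alpha>\<^sub>0 t x x) > Re (heat_kernel v \<beta> M ctr N \<alpha>\<^sub>1 t x x)"
proof (intro allI impI ballI)
  fix t :: real and x :: "'k ^ 'n"
  assume t: "0 < t" and x: "x \<in> Omega v N"
  interpret haar_field v \<beta> M "real CARD('n)"
    using assms(1-3) by unfold_locales auto
  let ?W = "wavelets v \<beta> M ctr N"
  have "1 \<le> real CARD('n)" by (simp add: Suc_le_eq)
  then have "1 \<le> \<alpha>\<^sub>0" using assms(6) by linarith
  then have "vt_lambda v M N \<alpha>\<^sub>0 < vt_lambda v M N \<alpha>\<^sub>1"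
    using assms(4,7) by (intro vt_lambda_strict_mono) auto
  then have "exp (- vt_lambda v M N \<alpha>\<^sub>1 * t) * q powr (- real CARD('n) * of_int N)
      < exp (- vt_lambda v M N \<alpha>\<^sub>0 * t) * q powr (- real CARD('n) * of_int N)"
    using t by (intro mult_strict_right_mono) auto
  moreover have "infsum (diag_term N \<alpha>\<^sub>1 t x) ?W \<le> infsum (diag_term N \<alpha>\<^sub>0 t x) ?W"
    using assms(4-7) t x
    by (intro infsum_mono diag_summable diag_term_antimono) auto
  ultimately have less: "exp (- vt_lambda v M N \<alpha>\<^sub>1 * t) * q powr (- real CARD('n) * of_int N)
        + infsum (diag_term N \<alpha>\<^sub>1 t x) ?W
      < exp (- vt_lambda v M N \<alpha>\<^sub>0 * t) * q powr (- real CARD('n) * of_int N)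
        + infsum (diag_term N \<alpha>\<^sub>0 t x) ?W"
    by (rule add_less_le_mono)
  have \<alpha>\<^sub>1: "real CARD('n) < \<alpha>\<^sub>1" using assms(6,7) by linarith
  note diag = heat_kernel_diag[OF assms(5) x assms(6) t] heat_kernel_diag[OF assms(5) x \<alpha>\<^sub>1 t]
  show "heat_kernel v \<beta> M ctr N \<alpha>\<^sub>0 t x x \<in> \<real> \<and>
      heat_kernel v \<beta> M ctr N \<alpha>\<^sub>1 t x x \<in> \<real> \<and>
      Re (heat_kernel v \<beta> M ctr N \<alpha>\<^sub>0 t x x) > Re (heat_kernel v \<beta> M ctr N \<alpha>\<^sub>1 t x x)"
    unfolding diag Re_complex_of_real using less by (intro conjI Reals_of_real)
qed

end
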